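(* Let $m\ge 4$ be the (fixed) number of alternatives. If profiles with $n$ agents are generated randomly according to the Impartial Anonymous Culture distribution, then the Dodgson Quick (DQ), Greedy and Tideman winners do not converge to the Dodgson winner as $n\to\infty$; that is, for each of these three rules, the probability that the rule picks the same winners as the Dodgson rule does not converge to $1$ as $n\to\infty$.
   Context: Let $\mathcal{A}$ be a finite set of $m$ alternatives. A profile is an array $\mathcal{P}=(P_1,\ldots,P_n)$ of $n$ votes, each vote being a linear order of $\mathcal{A}$; $xP_iy$ means that the $i$-th vote ranks $x$ above $y$. A voting situation is a multiset of $n$ linear orders of $\mathcal{A}$. The Impartial Anonymous Culture (IAC) assumption is that each voting situation with $n$ agents is equally likely. Put $n_{xy}=\#\{i\mid xP_iy\}$ and $\mathrm{adv}(a,b)=\max(0,n_{ab}-n_{ba})$. An alternative $a$ is a Condorcet-tie winner if $\mathrm{adv}(b,a)=0$ for all alternatives $b\neq a$. The winners under each of the following rules are the alternatives with the lowest score (all scores depend only on the voting situation). Tideman score: $\mathrm{Sc}_{\mathbf T}(a)=\sum_{b\ne a}\mathrm{adv}(b,a)$. DQ score: $\mathrm{Sc}_{\mathbf Q}(a)=\sum_{b\neq a}\lceil \mathrm{adv}(b,a)/2\rceil$. Dodgson score: $\mathrm{Sc}_{\mathbf D}(a)$ is the minimum number of swaps of neighbouring alternatives (within votes) required to make $a$ a Condorcet-tie winner. Greedy score: the score $\mathrm{GreedyScore}(a)$ assigned to each alternative in each voting situation by the greedy algorithm of Homan and Hemaspaandra for approximating the Dodgson score; the only property of it that is used is that $|\mathrm{GreedyScore}(a)-\mathrm{Sc}_{\mathbf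 Q}(a)|<m$ for every alternative $a$ in every voting situation. (The statement may be read as holding for any score with this property.) *)

theory Defs
  imports "HOL-Library.Multiset" "HOL-Probability.Probability"
begin

text \<open>
  A vote on \<open>A\<close> is a (reflexive) linear order \<open>r\<close> on \<open>A\<close>; \<open>(x, y) \<in> r\<close> with \<open>x \<noteq> y\<close> means that
  \<open>x\<close> is ranked above \<open>y\<close>.
\<close>

definition votes :: "'a set \<Rightarrow> 'a rel set" where
  "votes A = {r. linear_order_on A r}"

definition voting_situations :: "'a set \<Rightarrow> nat \<Rightarrow> 'a rel multiset set" where
  "voting_situations A n = multisets_of_size (votes A) n"

lemma finite_votes:
  assumes "finite A"
  shows "finite (votes A)"
proof (rule finite_subset)
  show "votes A \<subseteq> Pow (A \<times> A)"
    by (auto simp: votes_def order_on_defs)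
qed (use assms in auto)

lemma votes_nonempty: "votes A \<noteq> {}"
  using well_order_on[of A] by (auto simp: votes_def well_order_on_def)

lemma finite_voting_situations:
  assumes "finite A"
  shows "finite (voting_situations A n)"
  using finite_votes[OF assms] by (auto simp: voting_situations_def)

lemma voting_situations_nonempty: "voting_situations A n \<noteq> {}"
proof -
  obtain r where "r \<in> votes A"
    using votes_nonempty by blast
  hence "replicate_mset n r \<in> voting_situations A n"
    by (auto simp: voting_situations_def multisets_of_size_def)
  thus ?thesis by blast
qed

definition iac :: "'a set \<Rightarrow> nat \<Rightarrow> 'a rel multiset pmf" where
  "iac A n = pmf_of_set (voting_situations A n)"

lemma set_pmf_iac: "finite A \<Longrightarrow> set_pmf (iac A n) = voting_situations A n"
  by (simp add: iac_def finite_voting_situations voting_situations_nonempty)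

definition n_above :: "'a rel multiset \<Rightarrow> 'a \<Rightarrow> 'a \<Rightarrow> nat" where
  "n_above V x y = size {#r \<in># V. x \<noteq> y \<and> (x, y) \<in> r#}"

definition adv :: "'a rel multiset \<Rightarrow> 'a \<Rightarrow> 'a \<Rightarrow> int" where
  "adv V a b = max 0 (int (n_above V a b) - int (n_above V b a))"

definition condorcet_tie_winner :: "'a set \<Rightarrow> 'a rel multiset \<Rightarrow> 'a \<Rightarrow> bool" where
  "condorcet_tie_winner A V a \<longleftrightarrow> a \<in> A \<and> (\<forall>b\<in>A - {a}. adv V b a = 0)"

definition tideman_score :: "'a set \<Rightarrow> 'a rel multiset \<Rightarrow> 'a \<Rightarrow> int" where
  "tideman_score A V a = (\<Sum>b\<in>A - {a}. adv V b a)"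

definition dq_score :: "'a set \<Rightarrow> 'a rel multiset \<Rightarrow> 'a \<Rightarrow> int" where
  "dq_score A V a = (\<Sum>b\<in>A - {a}. \<lceil>real_of_int (adv V b a) / 2\<rceil>)"

definition neighbour_swap :: "'a rel \<Rightarrow> 'a rel \<Rightarrow> bool" where
  "neighbour_swap r r' \<longleftrightarrow>
     (\<exists>x y. x \<noteq> y \<and> (x, y) \<in> r \<and> (\<forall>z. (x, z) \<in> r \<and> (z, y) \<in> r \<longrightarrow> z = x \<or> z = y) \<and>
            r' = insert (y, x) (r - {(x, y)}))"

lemma neighbour_swap_votes:
  assumes "r \<in> votes A" "neighbour_swap r r'"
  shows "r' \<in> votes A"
proof -
  obtain x y where xy: "x \<noteq> y" "(x, y) \<in> r"
      "\<And>z. (x, z) \<in> r \<Longrightarrow> (z, y) \<in> r \<Longrightarrow> z = x \<or> z = y"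
      and r': "r' = insert (y, x) (r - {(x, y)})"
    using assms(2) by (auto simp: neighbour_swap_def)
  have sub: "r \<subseteq> A \<times> A" and refl: "refl_on A r" and tr: "trans r"
    and an: "antisym r" and tot: "total_on A r"
    using assms(1) by (auto simp: votes_def order_on_defs)
  have total: "(u, v) \<in> r \<or> (v, u) \<in> r" if "u \<in> A" "v \<in> A" for u v
    using that tot refl by (cases "u = v") (auto simp: total_on_def refl_on_def)
  have "trans r'"
  proof (rule transI)
    fix u v w assume uvw: "(u, v) \<in> r'" "(v, w) \<in> r'"
    have A: "u \<in> A" "v \<in> A" "w \<in> A" "x \<in> A" "y \<in> A"
      using uvw sub xy(2) by (auto simp: r')
    show "(u, w) \<in> r'"
      using uvw xy A total[of u x] total[of u y] total[of w x] total[of w y] total[of u w]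
        transD[OF tr] antisymD[OF an]
      unfolding r' by (smt (verit) Diff_iff insert_iff prod.inject singletonD)
  qed
  moreover have "antisym r'"
    using an xy by (auto simp: r' antisym_def)
  moreover have "r' \<subseteq> A \<times> A" "refl_on A r'" "total_on A r'"
    using sub refl tot xy by (auto simp: r' refl_on_def total_on_def)
  ultimately show ?thesis
    by (simp add: votes_def order_on_defs)
qed

definition swap_step :: "'a rel multiset \<Rightarrow> 'a rel multiset \<Rightarrow> bool" where
  "swap_step V V' \<longleftrightarrow> (\<exists>r r'. r \<in># V \<and> neighbour_swap r r' \<and> V' = add_mset r' (V - {#r#}))"

definition dodgson_score :: "'a set \<Rightarrow> 'a rel multiset \<Rightarrow> 'a \<Rightarrow> nat" where
  "dodgson_score A V a =
     (LEAST k. \<exists>V'. (swap_step ^^ k) V V' \<and> condorcet_tie_winner A V' a)"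

definition winners :: "'a set \<Rightarrow> ('a \<Rightarrow> 'b::linorder) \<Rightarrow> 'a set" where
  "winners A sc = {a \<in> A. \<forall>b\<in>A. sc a \<le> sc b}"

text \<open>
  A score function \<open>g\<close> (on voting situations over \<open>A\<close>) is greedy-like if it has the only property
  of the greedy approximation to the Dodgson score that matters asymptotically.
\<close>

definition greedy_like :: "'a set \<Rightarrow> ('a rel multiset \<Rightarrow> 'a \<Rightarrow> real) \<Rightarrow> bool" where
  "greedy_like A g \<longleftrightarrow>
     (\<forall>n. \<forall>V\<in>voting_situations A n. \<forall>a\<in>A.
        \<bar>g V a - real_of_int (dq_score A V a)\<bar> < real (card A))"

text \<open>
  The IAC probability that two scores, possibly with values in different types, have the same set
  of winners.
\<close>

definition prob_same_winners ::
  "'a set \<Rightarrow> nat \<Rightarrow> ('a rel multiset \<Rightarrow> 'a \<Rightarrow> 'b::linorder) \<Rightarrow>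
   ('a rel multiset \<Rightarrow> 'a \<Rightarrow> 'c::linorder) \<Rightarrow> real" where
  "prob_same_winners A n s t =
     measure_pmf.prob (iac A n) {V. winners A (s V) = winners A (t V)}"

end

theory Submission
  imports Defs
begin

text \<open>
  The Tideman and DQ scores see only the pairwise majorities, whereas the Dodgson score also depends
  on where in the votes a defeat can be repaired. Suppose that \<open>b\<close> is the only alternative that
  beats \<open>a\<close>, and that every vote placing \<open>b\<close> above \<open>a\<close> has a third alternative in between. Each vote
  in which \<open>a\<close> overtakes \<open>b\<close> then costs two swaps, one of them wasted on the alternative in between.
  So the Dodgson score of \<open>a\<close> is about its Tideman score and not half of it (\<open>dodgson_score_ge\<close>).
  Another alternative \<open>c\<close> may have a somewhat larger Tideman score and yet repair all its
  defeats by swaps each of which is useful, so that its Dodgson score is only half of its Tideman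
  score. The following \<open>26\<close> votes, best alternative first and all other alternatives below in a fixed
  order, realise this:
  \<open>7\<close> votes \<open>c b d a\<close>, \<open>5\<close> votes \<open>b d a c\<close>, \<open>4\<close> votes \<open>b c a d\<close>, \<open>10\<close> votes \<open>a d c b\<close>.
  The Tideman score of \<open>a\<close> is \<open>6\<close>, that of \<open>b\<close>, \<open>c\<close> and \<open>d\<close> is \<open>8\<close>, and that of the others is at
  least \<open>26\<close>. The Dodgson score of \<open>a\<close> is at least \<open>6\<close>, whereas changing two votes \<open>b d a c\<close> into
  \<open>b c d a\<close> takes \<open>4\<close> swaps and makes \<open>c\<close> a Condorcet-tie winner.

  The scores grow linearly under replication of these votes, so the gaps survive the addition of
  arbitrary votes, provided that their number is a small enough fraction of the whole. With \<open>m\<close>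
  alternatives, \<open>m * t\<close> copies of the \<open>26\<close> votes and \<open>t\<close> arbitrary further votes will do. The
  Tideman gap between \<open>a\<close> and the rest is then of order \<open>t\<close>, which also exceeds the bounded
  discrepancy between the Greedy score, the DQ score and half the Tideman score. Hence for each of
  the three rules \<open>a\<close> wins, while \<open>a\<close> is not a Dodgson winner.

  Under the Impartial Anonymous Culture, the voting situations that contain a prescribed
  subsituation are as many as the ways to choose the remaining votes. By the formula for the number
  of multisets, those with \<open>t\<close> free votes among \<open>q * t\<close> have probability at least \<open>1 / q ^ k\<close>, where
  \<open>k + 1\<close> is the number of linear orders (\<open>prob_iac_add_ge\<close>). With \<open>q = 26 * m + 1\<close> this bounds the
  probability of agreement away from \<open>1\<close> along the subsequence \<open>n = q * t\<close>.
\<close>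

section \<open>Counting voting situations\<close>

lemma card_multisets_of_size:
  assumes "finite S" "card S = Suc k"
  shows "card (multisets_of_size S n) = (n + k choose k)"
  using assms
proof (induction k arbitrary: S n)
  case 0
  then obtain x where x: "S = {x}"
    by (auto simp: card_Suc_eq)
  have "multisets_of_size S n = {replicate_mset n x}"
    unfolding x multisets_of_size_def by (auto dest: set_mset_subset_singletonD split: if_splits)
  thus ?case by simp
next
  case (Suc k)
  then obtain x S' where S: "S = insert x S'" "x \<notin> S'" "card S' = Suc k" "finite S'"
    by (metis card_Suc_eq finite_insert)
  have "card (multisets_of_size S n) = card (SIGMA m:{0..n}. multisets_of_size S' (n - m))"
    using bij_betw_multisets_of_size_insert[OF S(2)] unfolding S(1)
    by (metis bij_betw_same_card)
  also have "\<dots> = (\<Sum>m=0..n. (n - m + k choose k))"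
    using S Suc.IH[of S'] by (subst card_SigmaI) auto
  also have "\<dots> = (\<Sum>m=0..n. (k + m choose k))"
    by (rule sum.reindex_bij_witness[of _ "\<lambda>m. n - m" "\<lambda>m. n - m"]) (auto simp: add.commute)
  also have "\<dots> = (n + Suc k choose Suc k)"
    using choose_rising_sum(1)[of k n] by (simp add: atMost_atLeast0 add.commute)
  finally show ?case .
qed

text \<open>
  Up to the factor \<open>k!\<close> both sides are products of \<open>k\<close> factors, and \<open>q * t + i \<le> q * (t + i)\<close> for
  each of them.
\<close>

lemma choose_dilate_le: "(q * t + k choose k) \<le> q ^ k * (t + k choose k)" if "q \<ge> 1" for q t k :: nat
proof (induction k)
  case (Suc k)
  have "Suc k * (q * t + Suc k choose Suc k) = (q * t + Suc k) * (q * t + k choose k)"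
    using Suc_times_binomial[of k "q * t + k"] by simp
  also have "\<dots> \<le> (q * (t + Suc k)) * (q ^ k * (t + k choose k))"
    using mult_le_mono1[OF that, of "Suc k"]
    by (intro mult_mono Suc.IH) (auto simp: distrib_left)
  also have "\<dots> = q ^ Suc k * (Suc (t + k) * (t + k choose k))"
    by (simp only: power_Suc add_Suc_right ac_simps)
  also have "\<dots> = q ^ Suc k * (Suc k * (t + Suc k choose Suc k))"
    using Suc_times_binomial[of k "t + k"] by (simp only: add_Suc_right)
  also have "\<dots> = Suc k * (q ^ Suc k * (t + Suc k choose Suc k))"
    by (rule mult.left_commute)
  finally show ?case by (metis Suc_mult_le_cancel1)
qed simp

text \<open>
  Adding the fixed votes \<open>V0\<close> is injective, so the event has as many elements as there are voting
  situations with \<open>t\<close> votes. The bound is independent of \<open>t\<close> because both cardinalities are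
  polynomials in \<open>t\<close> of the same degree, one less than the number of linear orders.
\<close>

lemma prob_iac_add_ge:
  assumes "finite A" "q \<ge> 1" "set_mset V0 \<subseteq> votes A" "size V0 + t = q * t"
  shows "measure_pmf.prob (iac A (q * t)) ((+) V0 ` voting_situations A t) 
           \<ge> 1 / real q ^ (card (votes A) - 1)"
proof -
  define k where "k = card (votes A) - 1"
  have fin: "finite (votes A)" and fin': "finite (voting_situations A n)" for n
    using finite_votes finite_voting_situations assms(1) by auto
  have k: "card (votes A) = Suc k"
    using fin votes_nonempty[of A] by (simp add: k_def card_gt_0_iff)
  have c: "card (voting_situations A n) = (n + k choose k)" for n
    unfolding voting_situations_def by (rule card_multisets_of_size[OF fin k])
  have sub: "(+) V0 ` voting_situations A t \<subseteq> voting_situations A (q * t)"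
    using assms(3,4) by (auto simp: voting_situations_def multisets_of_size_def)
  have "card ((+) V0 ` voting_situations A t) = (t + k choose k)"
    by (simp add: card_image c)
  hence "measure_pmf.prob (iac A (q * t)) ((+) V0 ` voting_situations A t) 
        = (t + k choose k) / (q * t + k choose k)"
    using sub by (simp add: iac_def measure_pmf_of_set fin' voting_situations_nonempty c Int_absorb1)
  moreover have "1 / real q ^ k \<le> (t + k choose k) / (q * t + k choose k)"
  proof -
    have "real (q * t + k choose k) \<le> real q ^ k * real (t + k choose k)"
      using choose_dilate_le[OF assms(2), of t k] by (metis of_nat_le_iff of_nat_mult of_nat_power)
    moreover have "real (q * t + k choose k) > 0" "real q ^ k > 0"
      using assms(2) by (simp_all add: zero_less_binomial)
    ultimately show ?thesis by (subst frac_le_eq) (auto simp: field_simps)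
  qed
  ultimately show ?thesis by (simp only: k_def)
qed

section \<open>Pairwise comparisons\<close>

lemma n_above_empty [simp]: "n_above {#} x y = 0"
  and n_above_union [simp]: "n_above (V + W) x y = n_above V x y + n_above W x y"
  and n_above_add_mset: "n_above (add_mset r V) x y = (if x \<noteq> y \<and> (x, y) \<in> r then 1 else 0) + n_above V x y"
  by (auto simp: n_above_def)

lemma n_above_replicate [simp]:
  "n_above (replicate_mset k r) x y = (if x \<noteq> y \<and> (x, y) \<in> r then k else 0)"
  by (induction k) (auto simp: n_above_add_mset)

lemma n_above_le_size: "n_above V x y \<le> size V"
  by (simp add: n_above_def)

lemma n_above_add_le_size:
  assumes "set_mset V \<subseteq> votes A"
  shows "n_above V x y + n_above V y x \<le> size V"
  using assms
proof (induction V)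
  case (add r V)
  have "antisym r" using add.prems by (auto simp: votes_def order_on_defs)
  hence "x = y \<or> \<not> ((x, y) \<in> r \<and> (y, x) \<in> r)" by (auto dest: antisymD)
  thus ?case using add by (auto simp: n_above_add_mset)
qed simp

lemma adv_eq_0_iff: "adv V x y = 0 \<longleftrightarrow> n_above V x y \<le> n_above V y x"
  by (auto simp: adv_def)

lemma adv_union_bounds:
  "adv (V + W) x y \<le> adv V x y + int (size W)"
  "adv (V + W) x y \<ge> int (n_above V x y) - int (n_above V y x) - int (size W)"
  using n_above_le_size[of W x y] n_above_le_size[of W y x] by (auto simp: adv_def)

section \<open>Sequences of swaps and upper bounds for the Dodgson score\<close>

lemma swap_steps_union: "(swap_step ^^ k) V V' \<Longrightarrow> (swap_step ^^ k) (V + U) (V' + U)"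
proof (induction k arbitrary: V')
  case (Suc k)
  then obtain V1 where V1: "(swap_step ^^ k) V V1" "swap_step V1 V'" by auto
  then obtain r r' where "r \<in># V1" "neighbour_swap r r'" "V' = add_mset r' (V1 - {#r#})"
    by (auto simp: swap_step_def)
  hence "swap_step (V1 + U) (V' + U)"
    unfolding swap_step_def
    by (intro exI[of _ r] exI[of _ r']) auto
  thus ?case using Suc.IH[OF V1(1)] by auto
qed auto

lemma swap_steps_single: "(neighbour_swap ^^ k) r r' \<Longrightarrow> (swap_step ^^ k) {#r#} {#r'#}"
proof (induction k arbitrary: r')
  case (Suc k)
  then obtain s where s: "(neighbour_swap ^^ k) r s" "neighbour_swap s r'" by auto
  hence "swap_step {#s#} {#r'#}" by (auto simp: swap_step_def)
  with Suc.IH[OF s(1)] show ?case by auto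
qed auto

lemma swap_steps_add:
  assumes "(swap_step ^^ k) V V'" "(swap_step ^^ l) W W'"
  shows "(swap_step ^^ (k + l)) (V + W) (V' + W')"
proof -
  have "(swap_step ^^ l) (V' + W) (V' + W')"
    using swap_steps_union[OF assms(2), of V'] by (simp add: add.commute)
  thus ?thesis by (rule relpowp_trans[OF swap_steps_union[OF assms(1)]])
qed

lemma swap_steps_replicate:
  assumes "(neighbour_swap ^^ j) r r'"
  shows "(swap_step ^^ (j * k)) (replicate_mset k r) (replicate_mset k r')"
proof (induction k)
  case (Suc k)
  show ?case using swap_steps_add[OF swap_steps_single[OF assms] Suc] by simp
qed auto

lemma swap_steps_votes:
  assumes "(swap_step ^^ k) V V'" "set_mset V \<subseteq> votes A"
  shows "set_mset V' \<subseteq> votes A \<and> size V' = size V"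
  using assms
proof (induction k arbitrary: V')
  case (Suc k)
  then obtain V1 where V1: "(swap_step ^^ k) V V1" "swap_step V1 V'" by auto
  then obtain r r' where r: "r \<in># V1" "neighbour_swap r r'" "V' = add_mset r' (V1 - {#r#})"
    by (auto simp: swap_step_def)
  have *: "set_mset V1 \<subseteq> votes A \<and> size V1 = size V" by (rule Suc.IH[OF V1(1) Suc.prems(2)])
  with r have "r' \<in> votes A" using neighbour_swap_votes by blast
  with * r show ?case
    by (auto dest: in_diffD simp: size_Suc_Diff1)
qed auto

text \<open>
  As long as some alternative is above \<open>x\<close>, one of them is directly above \<open>x\<close>, and swapping the two
  lowers the number of alternatives above \<open>x\<close> by one.
\<close>

lemma neighbour_swaps_to_top:
  assumes "finite A" "r \<in> votes A" "x \<in> A"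
  shows "\<exists>k r'. k \<le> card A - 1 \<and> (neighbour_swap ^^ k) r r' \<and> (\<forall>y\<in>A. (x, y) \<in> r')"
proof -
  let ?S = "\<lambda>r. {y. y \<noteq> x \<and> (y, x) \<in> r}"
  have "\<exists>r'. (neighbour_swap ^^ card (?S r)) r r' \<and> (\<forall>y\<in>A. (x, y) \<in> r')"
    using assms(2)
  proof (induction "card (?S r)" arbitrary: r)
    case 0
    have sub: "r \<subseteq> A \<times> A" and refl: "refl_on A r" and tot: "total_on A r"
      using 0(2) by (auto simp: votes_def order_on_defs)
    have "finite (?S r)" by (rule finite_subset[OF _ assms(1)]) (use sub in auto)
    with 0 have "?S r = {}" by simp
    hence "\<forall>y\<in>A. (x, y) \<in> r"
      using refl tot assms(3) by (auto simp: total_on_def refl_on_def) metis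
    thus ?case using 0(1)[symmetric] by (intro exI[of _ r]) auto
  next
    case (Suc n)
    have sub: "r \<subseteq> A \<times> A" and refl: "refl_on A r" and tr: "trans r" and an: "antisym r"
      using Suc.prems by (auto simp: votes_def order_on_defs)
    have fS: "finite (?S r)" by (rule finite_subset[OF _ assms(1)]) (use sub in auto)
    have fr: "finite {z. (z, y) \<in> r}" for y
      by (rule finite_subset[OF _ assms(1)]) (use sub in auto)
    have ne: "?S r \<noteq> {}" using Suc.hyps(2) by (metis card.empty nat.distinct(1))
    \<comment> \<open>The alternative directly above \<open>x\<close> is the one that itself has the most alternatives above it.\<close>
    obtain y where y: "y \<in> ?S r"
       and ymax: "\<And>z. z \<in> ?S r \<Longrightarrow> card {w. (w, z) \<in> r} \<le> card {w. (w, y) \<in> r}"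
    proof -
      let ?f = "\<lambda>z. card {w. (w, z) \<in> r}"
      have "Max (?f ` ?S r) \<in> ?f ` ?S r" using fS ne by (intro Max_in) auto
      then obtain y where "y \<in> ?S r" "?f y = Max (?f ` ?S r)" by auto
      moreover have "?f z \<le> Max (?f ` ?S r)" if "z \<in> ?S r" for z
        using fS that by (intro Max_ge) auto
      ultimately show ?thesis using that by auto
    qed
    have adj: "z = y \<or> z = x" if z: "(y, z) \<in> r" "(z, x) \<in> r" for z
    proof (rule ccontr)
      assume n: "\<not> (z = y \<or> z = x)"
      have "(z, z) \<in> r" "(z, y) \<notin> r"
        using z n antisymD[OF an] refl sub by (auto simp: refl_on_def)
      moreover have "{w. (w, y) \<in> r} \<subseteq> {w. (w, z) \<in> r}"
        using z transD[OF tr] by auto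
      ultimately have "{w. (w, y) \<in> r} \<subset> {w. (w, z) \<in> r}" by blast
      hence "card {w. (w, y) \<in> r} < card {w. (w, z) \<in> r}" by (rule psubset_card_mono[OF fr])
      with ymax[of z] z n show False by auto
    qed
    let ?r = "insert (x, y) (r - {(y, x)})"
    have sw: "neighbour_swap r ?r"
      unfolding neighbour_swap_def using y adj by blast
    have "?S ?r = ?S r - {y}" using y by auto
    hence "n = card (?S ?r)" using Suc.hyps(2) y fS by simp
    from Suc.hyps(1)[OF this neighbour_swap_votes[OF Suc.prems sw]] this Suc.hyps(2) sw
    show ?case by (metis relpowp_Suc_I2)
  qed
  moreover have "card (?S r) \<le> card (A - {x})"
    using assms by (intro card_mono) (auto simp: votes_def order_on_defs)
  ultimately show ?thesis using assms by auto
qed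

lemma swap_steps_to_top:
  assumes "finite A" "x \<in> A" "set_mset V \<subseteq> votes A"
  shows "\<exists>k V'. k \<le> (card A - 1) * size V \<and> (swap_step ^^ k) V V' \<and>
     (\<forall>r\<in>#V'. \<forall>y\<in>A. (x, y) \<in> r)"
  using assms(3)
proof (induction V)
  case (add r V)
  then obtain k V' where k: "k \<le> (card A - 1) * size V" "(swap_step ^^ k) V V'"
    "\<forall>r\<in>#V'. \<forall>y\<in>A. (x, y) \<in> r" by auto
  from add.prems have "r \<in> votes A" by auto
  from neighbour_swaps_to_top[OF assms(1) this assms(2)] obtain l r'
    where l: "l \<le> card A - 1" "(neighbour_swap ^^ l) r r'" "\<forall>y\<in>A. (x, y) \<in> r'" by auto
  show ?case
    using swap_steps_add[OF swap_steps_single[OF l(2)] k(2)] k l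
    by (intro exI[of _ "l + k"] exI[of _ "{#r'#} + V'"]) auto
next
  case empty
  show ?case by (intro exI[of _ 0] exI[of _ "{#}"]) auto
qed

lemma n_above_eq_0_of_top:
  assumes "set_mset V \<subseteq> votes A" "\<forall>r\<in>#V. \<forall>y\<in>A. (x, y) \<in> r" "y \<in> A"
  shows "n_above V y x = 0"
proof -
  have "\<not> (y \<noteq> x \<and> (y, x) \<in> r)" if "r \<in># V" for r
  proof -
    have "antisym r" using that assms(1) by (auto simp: votes_def order_on_defs)
    moreover have "(x, y) \<in> r" using that assms by auto
    ultimately show ?thesis by (auto dest: antisymD)
  qed
  thus ?thesis by (auto simp: n_above_def multiset_eq_iff not_in_iff[symmetric] simp flip: not_in_iff)
qed

text \<open>
  The votes \<open>W\<close> are handled by brute force, at the cost of lifting \<open>x\<close> to the top of each of them;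
  they then only support \<open>x\<close> and cannot spoil what was achieved in \<open>V\<close>.
\<close>

lemma dodgson_score_le:
  assumes "finite A" "x \<in> A" "set_mset W \<subseteq> votes A"
    and "(swap_step ^^ k) V V'" "condorcet_tie_winner A V' x"
  shows "dodgson_score A (V + W) x \<le> k + (card A - 1) * size W"
proof -
  obtain l W' where l: "l \<le> (card A - 1) * size W" "(swap_step ^^ l) W W'"
     "\<forall>r\<in>#W'. \<forall>y\<in>A. (x, y) \<in> r"
    using swap_steps_to_top[OF assms(1-3)] by auto
  have "set_mset W' \<subseteq> votes A" using swap_steps_votes[OF l(2) assms(3)] by auto
  hence "n_above W' y x = 0" if "y \<in> A" for y by (rule n_above_eq_0_of_top[OF _ l(3) that])
  hence "condorcet_tie_winner A (V' + W') x"
    using assms(5) unfolding condorcet_tie_winner_def adv_eq_0_iff by (simp add: trans_le_add1)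
  hence "dodgson_score A (V + W) x \<le> k + l"
    unfolding dodgson_score_def
    using swap_steps_add[OF assms(4) l(2)] by (intro Least_le) auto
  with l(1) show ?thesis by simp
qed

text \<open>
  A number defined by \<open>LEAST\<close> has the property that defines it only if some number has it; lifting
  \<open>x\<close> to the top of every vote provides one.
\<close>

lemma dodgson_score_attained:
  assumes "finite A" "x \<in> A" "set_mset V \<subseteq> votes A"
  shows "\<exists>V'. (swap_step ^^ dodgson_score A V x) V V' \<and> condorcet_tie_winner A V' x"
proof -
  obtain k V' where k: "(swap_step ^^ k) V V'" "\<forall>r\<in>#V'. \<forall>y\<in>A. (x, y) \<in> r"
    using swap_steps_to_top[OF assms(1-3)] by auto
  have "set_mset V' \<subseteq> votes A" using swap_steps_votes[OF k(1) assms(3)] by auto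
  hence "n_above V' y x = 0" if "y \<in> A" for y by (rule n_above_eq_0_of_top[OF _ k(2) that])
  hence "condorcet_tie_winner A V' x"
    using assms(2) by (auto simp: condorcet_tie_winner_def adv_eq_0_iff)
  with k(1) show ?thesis unfolding dodgson_score_def
    by (intro LeastI[of "\<lambda>k. \<exists>V'. (swap_step ^^ k) V V' \<and> condorcet_tie_winner A V' x" k]) auto
qed

section \<open>A lower bound for the Dodgson score\<close>

text \<open>
  This is the number of swaps needed to bring \<open>a\<close> above \<open>b\<close> in a linear order \<open>r\<close>, truncated at \<open>2\<close>.
\<close>

definition overtaking_cost :: "'a \<Rightarrow> 'a \<Rightarrow> 'a rel \<Rightarrow> nat" where
  "overtaking_cost a b r =
     (if (b, a) \<notin> r then 0
      else if \<exists>z. z \<noteq> a \<and> z \<noteq> b \<and> (b, z) \<in> r \<and> (z, a) \<in> r then 2 else 1)"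

lemma overtaking_cost_eq_2:
  "(b, z) \<in> r \<Longrightarrow> (z, a) \<in> r \<Longrightarrow> (b, a) \<in> r \<Longrightarrow> z \<noteq> a \<Longrightarrow> z \<noteq> b \<Longrightarrow> overtaking_cost a b r = 2"
  by (auto simp: overtaking_cost_def)

text \<open>
  The order of \<open>a\<close> and \<open>b\<close> is reversed only by swapping them with each other, which requires them
  to be neighbours. So a vote of cost \<open>2\<close> cannot become one of cost \<open>0\<close> in one swap.
\<close>

lemma overtaking_cost_swap:
  assumes "neighbour_swap r r'"
  shows "overtaking_cost a b r \<le> Suc (overtaking_cost a b r')"
  using assms unfolding neighbour_swap_def overtaking_cost_def by auto

lemma overtaking_cost_swap_steps:
  "(swap_step ^^ k) V V' \<Longrightarrow> 
     (\<Sum>r\<in>#V. overtaking_cost a b r) \<le> (\<Sum>r\<in>#V'. overtaking_cost a b r) + k"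
proof (induction k arbitrary: V')
  case (Suc k)
  then obtain V1 where V1: "(swap_step ^^ k) V V1" "swap_step V1 V'" by auto
  then obtain r r' where r: "r \<in># V1" "neighbour_swap r r'" "V' = add_mset r' (V1 - {#r#})"
    by (auto simp: swap_step_def)
  obtain U where U: "V1 = add_mset r U" using r(1) by (metis insert_DiffM)
  show ?case using Suc.IH[OF V1(1)] overtaking_cost_swap[OF r(2), of a b] r(3) U by simp
qed auto

text \<open>
  The total overtaking cost drops by at most one per swap. Once \<open>a\<close> is a Condorcet-tie winner, at
  most half of the votes place \<open>b\<close> above \<open>a\<close>, each of cost at most \<open>2\<close>, so the total is then at most
  the number of votes.
\<close>

lemma dodgson_score_ge:
  assumes "finite A" "a \<in> A" "b \<in> A" "a \<noteq> b" "set_mset V \<subseteq> votes A"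
  shows "(\<Sum>r\<in>#V. overtaking_cost a b r) \<le> size V + dodgson_score A V a"
proof -
  obtain V' where V': "(swap_step ^^ dodgson_score A V a) V V'" "condorcet_tie_winner A V' a"
    using dodgson_score_attained[OF assms(1,2,5)] by auto
  have v: "set_mset V' \<subseteq> votes A" "size V' = size V"
    using swap_steps_votes[OF V'(1) assms(5)] by auto
  have "(\<Sum>r\<in>#V'. overtaking_cost a b r) \<le> 2 * n_above V' b a"
    using assms(4) by (induction V') (auto simp: overtaking_cost_def n_above_add_mset)
  also have "n_above V' b a \<le> n_above V' a b"
    using V'(2) assms(3,4) by (auto simp: condorcet_tie_winner_def adv_eq_0_iff)
  hence "2 * n_above V' b a \<le> size V'"
    using n_above_add_le_size[OF v(1), of a b] by simp
  finally show ?thesis using overtaking_cost_swap_steps[OF V'(1), of a b] v by simp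
qed

section \<open>Votes given by lists\<close>

text \<open>The vote that ranks the elements of a list in their order, the head being the best.\<close>

primrec ranking :: "'a list \<Rightarrow> 'a rel" where
  "ranking [] = {}"
| "ranking (x # xs) = {x} \<times> set (x # xs) \<union> ranking xs"

lemma ranking_subset: "ranking xs \<subseteq> set xs \<times> set xs"
  by (induction xs) auto

lemma notin_ranking [simp]: "x \<notin> set xs \<Longrightarrow> (x, y) \<notin> ranking xs" "y \<notin> set xs \<Longrightarrow> (x, y) \<notin> ranking xs"
  using ranking_subset by fast+

lemma ranking_append: "ranking (xs @ ys) = ranking xs \<union> set xs \<times> set ys \<union> ranking ys"
  by (induction xs) auto

lemma ranking_votes: "distinct xs \<Longrightarrow> ranking xs \<in> votes (set xs)"
proof (induction xs)
  case Nil
  show ?case by (simp add: votes_def order_on_defs refl_on_def)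
next
  case (Cons x xs)
  have "trans (ranking xs)" "antisym (ranking xs)" "refl_on (set xs) (ranking xs)"
    "total_on (set xs) (ranking xs)"
    using Cons by (auto simp: votes_def order_on_defs)
  moreover have "x \<notin> set xs" using Cons.prems by simp
  moreover have sub: "ranking (x # xs) \<subseteq> set (x # xs) \<times> set (x # xs)" by (rule ranking_subset)
  moreover have "trans (ranking (x # xs))"
    using \<open>trans (ranking xs)\<close> \<open>x \<notin> set xs\<close> ranking_subset[of xs]
    by (auto intro!: transI dest: transD)
  moreover have "antisym (ranking (x # xs))"
    using \<open>antisym (ranking xs)\<close> \<open>x \<notin> set xs\<close> ranking_subset[of xs]
    by (auto intro!: antisymI dest: antisymD)
  ultimately show ?case
    unfolding votes_def order_on_defs mem_Collect_eq
    by (auto simp: refl_on_def total_on_def)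
qed

lemma neighbour_swap_ranking:
  assumes "distinct (xs @ x # y # ys)"
  shows "neighbour_swap (ranking (xs @ x # y # ys)) (ranking (xs @ y # x # ys))"
  unfolding neighbour_swap_def
proof (rule exI[of _ x], rule exI[of _ y], intro conjI allI impI)
  let ?r = "ranking (xs @ x # y # ys)"
  show "x \<noteq> y" "(x, y) \<in> ?r" using assms by (auto simp: ranking_append)
  show "z = x \<or> z = y" if "(x, z) \<in> ?r \<and> (z, y) \<in> ?r" for z
    using that assms by (auto simp: ranking_append)
  show "ranking (xs @ y # x # ys) = insert (y, x) (?r - {(x, y)})"
    using assms ranking_subset[of xs] ranking_subset[of ys] by (auto simp: ranking_append)
qed

section \<open>The core situation\<close>

text \<open>
  The multiplicities make \<open>b\<close> the only alternative that beats \<open>a\<close> and never let \<open>b\<close> be directly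
  above \<open>a\<close>. They let \<open>a\<close> and \<open>d\<close> beat \<open>c\<close> by the same margin, and in the votes \<open>b d a c\<close> these
  two are the ones that \<open>c\<close> meets first on its way up. Further, \<open>c\<close> beats \<open>b\<close>, and both \<open>b\<close> and \<open>a\<close> beat \<open>d\<close>, so that \<open>b\<close> and \<open>d\<close>
  have larger Tideman scores than \<open>a\<close>.
\<close>

definition core_situation :: "'a \<Rightarrow> 'a \<Rightarrow> 'a \<Rightarrow> 'a \<Rightarrow> 'a list \<Rightarrow> nat \<Rightarrow> 'a rel multiset" where
  "core_situation a b c d es N =
     replicate_mset (7 * N) (ranking ([c, b, d, a] @ es)) +
     replicate_mset (5 * N) (ranking ([b, d, a, c] @ es)) +
     replicate_mset (4 * N) (ranking ([b, c, a, d] @ es)) +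
     replicate_mset (10 * N) (ranking ([a, d, c, b] @ es))"

lemma core_votes:
  assumes "distinct ([a, b, c, d] @ es)"
  shows "set_mset (core_situation a b c d es N) \<subseteq> votes (set ([a, b, c, d] @ es))"
proof -
  have "ranking xs \<in> votes (set ([a, b, c, d] @ es))"
    if "set xs = set ([a, b, c, d] @ es)" "distinct xs" for xs
    using ranking_votes[OF that(2)] that(1) by simp
  note * = this[of "[c, b, d, a] @ es"] this[of "[b, d, a, c] @ es"] 
    this[of "[b, c, a, d] @ es"] this[of "[a, d, c, b] @ es"]
  have "set_mset (replicate_mset k r) \<subseteq> {r}" for k and r :: "'a rel" by simp
  moreover have "ranking ([c, b, d, a] @ es) \<in> votes (set ([a, b, c, d] @ es))"
    "ranking ([b, d, a, c] @ es) \<in> votes (set ([a, b, c, d] @ es))"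
    "ranking ([b, c, a, d] @ es) \<in> votes (set ([a, b, c, d] @ es))"
    "ranking ([a, d, c, b] @ es) \<in> votes (set ([a, b, c, d] @ es))"
    by (rule *; use assms in auto)+
  ultimately show ?thesis unfolding core_situation_def set_mset_union by blast
qed

lemma size_core [simp]: "size (core_situation a b c d es N) = 26 * N"
  by (simp add: core_situation_def)

lemma n_above_core:
  assumes "distinct ([a, b, c, d] @ es)"
  shows "n_above (core_situation a b c d es N) b a = 16 * N" "n_above (core_situation a b c d es N) a b = 10 * N"
    "n_above (core_situation a b c d es N) c a = 11 * N" "n_above (core_situation a b c d es N) a c = 15 * N"
    "n_above (core_situation a b c d es N) d a = 12 * N" "n_above (core_situation a b c d es N) a d = 14 * N"
    "n_above (core_situation a b c d es N) c b = 17 * N" "n_above (core_situation a b c d es N) b c = 9 * N"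
    "n_above (core_situation a b c d es N) d b = 10 * N" "n_above (core_situation a b c d es N) b d = 16 * N"
    "n_above (core_situation a b c d es N) c d = 11 * N" "n_above (core_situation a b c d es N) d c = 15 * N"
    "e \<in> set es \<Longrightarrow> n_above (core_situation a b c d es N) a e = 26 * N"
    "e \<in> set es \<Longrightarrow> n_above (core_situation a b c d es N) e a = 0"
  using assms by (simp_all add: core_situation_def) auto

text \<open>
  Each further vote changes each margin by at most one. In the second bound, an alternative other
  than \<open>a\<close> loses either at least \<open>8 * N\<close> to one opponent (\<open>b\<close> to \<open>c\<close>, and each alternative of \<open>es\<close>
  to \<open>a\<close>) or \<open>8 * N\<close> in total to two opponents (\<open>c\<close> to \<open>a\<close> and \<open>d\<close>, and \<open>d\<close> to \<open>a\<close> and \<open>b\<close>).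
\<close>

lemma tideman_score_core:
  fixes N :: nat and W :: "'a rel multiset"
  assumes "distinct ([a, b, c, d] @ es)" "A = set ([a, b, c, d] @ es)"
  defines "V \<equiv> core_situation a b c d es N + W"
  shows "tideman_score A V a \<le> 6 * int N + (int (card A) - 1) * int (size W)"
    and "y \<in> A - {a} \<Longrightarrow> tideman_score A V y \<ge> 8 * int N - 2 * int (size W)"
proof -
  note n = n_above_core[OF assms(1), where N = N]
  note lower = adv_union_bounds(2)[where V = "core_situation a b c d es N" and W = W]
  have fin: "finite A" using assms(2) by simp
  have nonneg: "adv V x y \<ge> 0" for x y by (simp add: adv_def)
  have "adv V y a \<le> (if y = b then 6 * int N else 0) + int (size W)" if "y \<in> A - {a}" for y
  proof -
    have "adv (core_situation a b c d es N) y a \<le> (if y = b then 6 * int N else 0)"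
      using that assms(1,2) n by (auto simp: adv_def)
    thus ?thesis using adv_union_bounds(1)[of "core_situation a b c d es N" W y a] by (simp add: V_def)
  qed
  hence "tideman_score A V a \<le> (\<Sum>y\<in>A - {a}. (if y = b then 6 * int N else 0) + int (size W))"
    unfolding tideman_score_def by (intro sum_mono)
  also have "\<dots> = 6 * int N + (int (card A) - 1) * int (size W)"
    using fin assms(1,2) by (simp add: sum.distrib of_nat_diff card_gt_0_iff Suc_leI)
  finally show "tideman_score A V a \<le> 6 * int N + (int (card A) - 1) * int (size W)" .
  have sub: "tideman_score A V y \<ge> (\<Sum>x\<in>X. adv V x y)" if "X \<subseteq> A - {y}" for X y
    unfolding tideman_score_def using that fin nonneg by (intro sum_mono2) auto
  have ne: "a \<noteq> b" "c \<noteq> b" "a \<noteq> c" "d \<noteq> c" "a \<noteq> d" "b \<noteq> d" using assms(1) by auto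
  assume y: "y \<in> A - {a}"
  then consider "y = b" | "y = c" | "y = d" | "y \<in> set es" using assms(2) by auto
  thus "tideman_score A V y \<ge> 8 * int N - 2 * int (size W)"
  proof cases
    case 1
    show ?thesis using sub[of "{c}" b] lower[of c b] n ne assms(2) 1 by (simp add: V_def)
  next
    case 2
    show ?thesis using sub[of "{a, d}" c] lower[of a c] lower[of d c] n ne assms(2) 2 by (simp add: V_def)
  next
    case 3
    show ?thesis using sub[of "{a, b}" d] lower[of a d] lower[of b d] n ne assms(2) 3 by (simp add: V_def)
  next
    case 4
    hence "y \<noteq> a" using y by auto
    thus ?thesis using sub[of "{a}" y] lower[of a y] n(13,14)[OF 4] assms(2) by (simp add: V_def)
  qed
qed

text \<open>
  In \<open>16 * N\<close> of the \<open>26 * N\<close> core votes \<open>b\<close> is above \<open>a\<close>, never directly, which gives the lower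
  bound \<open>32 * N - 26 * N\<close> up to the contribution of \<open>W\<close>.
\<close>

lemma dodgson_score_core_ge:
  assumes "distinct ([a, b, c, d] @ es)" "A = set ([a, b, c, d] @ es)" "set_mset W \<subseteq> votes A"
  shows "6 * N \<le> dodgson_score A (core_situation a b c d es N + W) a + size W"
proof -
  let ?V = "core_situation a b c d es N"
  have "overtaking_cost a b (ranking ([c, b, d, a] @ es)) = 2"
    using assms(1) by (intro overtaking_cost_eq_2[where z = d]) auto
  moreover have "overtaking_cost a b (ranking ([b, d, a, c] @ es)) = 2"
    using assms(1) by (intro overtaking_cost_eq_2[where z = d]) auto
  moreover have "overtaking_cost a b (ranking ([b, c, a, d] @ es)) = 2"
    using assms(1) by (intro overtaking_cost_eq_2[where z = c]) auto
  ultimately have "(\<Sum>r\<in>#?V. overtaking_cost a b r) \<ge> 32 * N"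
    unfolding core_situation_def image_mset_union sum_mset.union image_replicate_mset sum_mset_replicate_mset
    by simp
  moreover have "(\<Sum>r\<in>#?V + W. overtaking_cost a b r) \<le> size (?V + W) + dodgson_score A (?V + W) a"
    using assms core_votes[OF assms(1), of N] by (intro dodgson_score_ge) auto
  ultimately show ?thesis by simp
qed

text \<open>
  Changing \<open>2 * N\<close> votes \<open>b d a c\<close> into \<open>b c d a\<close> turns both defeats of \<open>c\<close>, each by \<open>4 * N\<close>, into
  ties. Each of these votes needs two swaps, and each swap helps against one of the two.
\<close>

lemma dodgson_score_core_le:
  assumes "distinct ([a, b, c, d] @ es)" "A = set ([a, b, c, d] @ es)" "set_mset W \<subseteq> votes A"
  shows "dodgson_score A (core_situation a b c d es N + W) c \<le> 4 * N + (card A - 1) * size W"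
proof -
  let ?r = "ranking ([b, d, a, c] @ es)" and ?s = "ranking ([b, c, d, a] @ es)"
  define U where "U = replicate_mset (7 * N) (ranking ([c, b, d, a] @ es)) +
     replicate_mset (3 * N) ?r +
     replicate_mset (4 * N) (ranking ([b, c, a, d] @ es)) +
     replicate_mset (10 * N) (ranking ([a, d, c, b] @ es))"
  have "replicate_mset (5 * N) x = replicate_mset (2 * N) x + replicate_mset (3 * N) x" for x :: "'a rel"
    by (simp add: multiset_eq_iff)
  hence core_situation: "core_situation a b c d es N = replicate_mset (2 * N) ?r + U"
    by (simp add: core_situation_def U_def)
  have "neighbour_swap ?r (ranking ([b, d, c, a] @ es))"
    using neighbour_swap_ranking[of "[b, d]" a c es] assms(1) by auto
  moreover have "neighbour_swap (ranking ([b, d, c, a] @ es)) ?s"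
    using neighbour_swap_ranking[of "[b]" d c "a # es"] assms(1) by auto
  ultimately have "(neighbour_swap ^^ 2) ?r ?s"
    unfolding numeral_2_eq_2 by auto
  from swap_steps_union[OF swap_steps_replicate[OF this, of "2 * N"], of U]
  have steps: "(swap_step ^^ (4 * N)) (core_situation a b c d es N) (replicate_mset (2 * N) ?s + U)"
    by (simp add: core_situation)
  have "condorcet_tie_winner A (replicate_mset (2 * N) ?s + U) c"
    unfolding condorcet_tie_winner_def using assms(1,2) by (auto simp: U_def adv_eq_0_iff)
  from dodgson_score_le[OF _ _ assms(3) steps this] show ?thesis
    using assms(2) by simp
qed

section \<open>Disagreement with the Dodgson rule\<close>

text \<open>
  Only a score's reaction to large Tideman gaps matters, which treats the three rules at once. The
  threshold \<open>5 * card A\<close> is what the Greedy score needs: its bound costs \<open>card A\<close> for each of the two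
  alternatives, which is \<open>4 * card A\<close> on the scale of the Tideman score, and the rounding in the
  DQ score costs less than \<open>card A\<close>.
\<close>

lemma prob_same_winners_not_tendsto_1:
  fixes A :: "'a set" and s :: "'a rel multiset \<Rightarrow> 'a \<Rightarrow> 'b :: linorder"
  assumes "finite A" "card A \<ge> 4"
    and s: "\<And>n V x y. V \<in> voting_situations A n \<Longrightarrow> x \<in> A \<Longrightarrow> y \<in> A \<Longrightarrow>
      tideman_score A V x + 5 * int (card A) \<le> tideman_score A V y \<Longrightarrow> s V x < s V y"
  shows "\<not> (\<lambda>n. prob_same_winners A n s (dodgson_score A)) \<longlonglongrightarrow> 1"
proof
  assume lim: "(\<lambda>n. prob_same_winners A n s (dodgson_score A)) \<longlonglongrightarrow> 1"
  obtain xs where xs: "distinct xs" "set xs = A"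
    using finite_distinct_list[OF assms(1)] by auto
  have "length xs \<ge> 4" using xs assms(2) distinct_card by fastforce
  then obtain a b c d es where "xs = [a, b, c, d] @ es"
    by (auto simp: Suc_le_length_iff numeral_eq_Suc)
  with xs have abcd: "distinct ([a, b, c, d] @ es)" "A = set ([a, b, c, d] @ es)" by auto
  define m where "m = card A"
  define q where "q = 26 * m + 1"
  define \<delta> where "\<delta> = 1 / real q ^ (card (votes A) - 1)"
  have bound: "prob_same_winners A (q * t) s (dodgson_score A) \<le> 1 - \<delta>" if t: "t \<ge> 7" for t
  proof -
    let ?V0 = "core_situation a b c d es (m * t)" and ?S = "{V. winners A (s V) = winners A (dodgson_score A V)}"
    have V0: "set_mset ?V0 \<subseteq> votes A" using core_votes[OF abcd(1)] abcd(2) by simp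
    have "winners A (s V) \<noteq> winners A (dodgson_score A V)"
      if V: "V \<in> (+) ?V0 ` voting_situations A t" for V
    proof -
      obtain W where W: "V = ?V0 + W" "size W = t" "set_mset W \<subseteq> votes A"
        using V by (auto simp: voting_situations_def multisets_of_size_def)
      have VS: "V \<in> voting_situations A (q * t)"
        using V0 W by (auto simp: voting_situations_def multisets_of_size_def q_def)
      have "s V a < s V y" if y: "y \<in> A - {a}" for y
      proof (rule s[OF VS])
        \<comment> \<open>The gap is at least \<open>(m - 1) * t\<close>, which for \<open>m \<ge> 4\<close> reaches \<open>5 * m\<close> from \<open>t = 7\<close> on.\<close>
        have "7 * (int m - 1) \<le> int t * (int m - 1)"
          using t assms(2) by (intro mult_right_mono) (auto simp: m_def)
        hence "5 * int m \<le> 2 * (int m * int t) - (int m + 1) * int t"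
          using assms(2) by (simp add: m_def algebra_simps)
        thus "tideman_score A V a + 5 * int (card A) \<le> tideman_score A V y"
          using tideman_score_core(1)[OF abcd, of "m * t" W] tideman_score_core(2)[OF abcd y, of "m * t" W]
          by (simp add: W m_def[symmetric] algebra_simps)
      qed (use y abcd in auto)
      hence "a \<in> winners A (s V)"
        using abcd(2) unfolding winners_def by (auto intro: less_imp_le)
      moreover have "a \<notin> winners A (dodgson_score A V)"
      proof -
        have "4 * (m * t) + (card A - 1) * t + t < 6 * (m * t)"
        proof -
          have "(card A - 1) * t + t = m * t"
            using assms(2) by (simp add: m_def algebra_simps)
          moreover have "m * t > 0" using t assms(2) by (simp add: m_def)
          ultimately show ?thesis by linarith
        qed
        hence "dodgson_score A V c < dodgson_score A V a"
          using dodgson_score_core_ge[OF abcd W(3), of "m * t"] 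
            dodgson_score_core_le[OF abcd W(3), of "m * t"] W by simp
        thus ?thesis using abcd(2) by (auto simp: winners_def)
      qed
      ultimately show ?thesis by blast
    qed
    hence "(+) ?V0 ` voting_situations A t \<subseteq> - ?S" by auto
    hence "measure_pmf.prob (iac A (q * t)) ((+) ?V0 ` voting_situations A t) 
      \<le> measure_pmf.prob (iac A (q * t)) (- ?S)"
      by (intro measure_pmf.finite_measure_mono) auto
    moreover have "\<delta> \<le> measure_pmf.prob (iac A (q * t)) ((+) ?V0 ` voting_situations A t)"
      unfolding \<delta>_def using assms(1) V0 by (intro prob_iac_add_ge) (auto simp: q_def)
    ultimately show ?thesis
      unfolding prob_same_winners_def
      using measure_pmf.prob_compl[of ?S "iac A (q * t)"] by (simp add: Compl_eq_Diff_UNIV)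
  qed
  have "strict_mono (\<lambda>t. q * t)" by (intro strict_monoI mult_strict_left_mono) (auto simp: q_def)
  from LIMSEQ_subseq_LIMSEQ[OF lim this]
  have "(\<lambda>t. prob_same_winners A (q * t) s (dodgson_score A)) \<longlonglongrightarrow> 1" by (simp add: o_def)
  hence "1 \<le> 1 - \<delta>" by (rule LIMSEQ_le_const2) (use bound in blast)
  moreover have "\<delta> > 0" by (simp add: \<delta>_def q_def)
  ultimately show False by simp
qed

lemma dq_score_bounds:
  assumes "finite A" "x \<in> A"
  shows "tideman_score A V x \<le> 2 * dq_score A V x"
    and "2 * dq_score A V x \<le> tideman_score A V x + int (card A) - 1"
proof -
  have "2 * \<lceil>real_of_int z / 2\<rceil> \<in> {z..z + 1}" for z
    by (auto; linarith)
  hence *: "adv V y x \<le> 2 * \<lceil>real_of_int (adv V y x) / 2\<rceil>" 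
    "2 * \<lceil>real_of_int (adv V y x) / 2\<rceil> \<le> adv V y x + 1" for y
    by (metis atLeastAtMost_iff)+
  show "tideman_score A V x \<le> 2 * dq_score A V x"
    unfolding tideman_score_def dq_score_def sum_distrib_left by (intro sum_mono *)
  have "2 * dq_score A V x \<le> (\<Sum>y\<in>A - {x}. adv V y x + 1)"
    unfolding dq_score_def sum_distrib_left by (intro sum_mono *)
  also have "\<dots> = tideman_score A V x + int (card A) - 1"
  proof -
    have "card A \<ge> 1" using assms by (metis One_nat_def Suc_leI card_gt_0_iff empty_iff)
    thus ?thesis using assms by (simp add: sum.distrib tideman_score_def of_nat_diff)
  qed
  finally show "2 * dq_score A V x \<le> tideman_score A V x + int (card A) - 1" .
qed

theorem theorem5p10:
  fixes A :: "'a set" and m :: nat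
  assumes "finite A" and "card A = m" and "m \<ge> 4"
  shows "\<not> (\<lambda>n. prob_same_winners A n (dq_score A) (dodgson_score A)) \<longlonglongrightarrow> 1 \<and>
    (\<forall>g. greedy_like A g \<longrightarrow>
       \<not> (\<lambda>n. prob_same_winners A n g (dodgson_score A)) \<longlonglongrightarrow> 1) \<and>
    \<not> (\<lambda>n. prob_same_winners A n (tideman_score A) (dodgson_score A)) \<longlonglongrightarrow> 1"
proof (intro conjI allI impI)
  have m: "card A \<ge> 4" using assms by simp
  note crit = prob_same_winners_not_tendsto_1[OF assms(1) m]
  note dq = dq_score_bounds[OF assms(1)]
  show "\<not> (\<lambda>n. prob_same_winners A n (tideman_score A) (dodgson_score A)) \<longlonglongrightarrow> 1"
    using m by (intro crit) auto
  show "\<not> (\<lambda>n. prob_same_winners A n (dq_score A) (dodgson_score A)) \<longlonglongrightarrow> 1"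
  proof (rule crit)
    fix n V x y assume "x \<in> A" "y \<in> A" "tideman_score A V x + 5 * int (card A) \<le> tideman_score A V y"
    thus "dq_score A V x < dq_score A V y" using dq(2)[of x V] dq(1)[of y V] m by linarith
  qed
  fix g assume g: "greedy_like A g"
  show "\<not> (\<lambda>n. prob_same_winners A n g (dodgson_score A)) \<longlonglongrightarrow> 1"
  proof (rule crit)
    fix n V x y assume V: "V \<in> voting_situations A n" and xy: "x \<in> A" "y \<in> A"
      and gap: "tideman_score A V x + 5 * int (card A) \<le> tideman_score A V y"
    have "\<bar>g V z - real_of_int (dq_score A V z)\<bar> < real (card A)" if "z \<in> A" for z
      using g V that by (auto simp: greedy_like_def)
    from this[OF xy(1)] this[OF xy(2)]
    have "g V x < dq_score A V x + real (card A)" "g V y > dq_score A V y - real (card A)"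
      by linarith+
    moreover have "2 * dq_score A V x + 4 * int (card A) < 2 * dq_score A V y"
      using dq(2)[OF xy(1), of V] dq(1)[OF xy(2), of V] gap by linarith
    ultimately show "g V x < g V y" by linarith
  qed
qed

end
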